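(* Let $h\geq 4$ be an integer, let $n=2^h$, and let $\overline{\Gamma_{2^h}}=\overline{C_{2^h}(1,2,2^2,\ldots,2^{h-1})}$ be the complement of the circulant graph $C_{2^h}(1,2,2^2,\ldots,2^{h-1})$. Then: (i) $W(\overline{\Gamma_{2^h}})=\frac{n(n+2h-2)}{2}$; (ii) $S(\overline{\Gamma_{2^h}})=n(n-2h)(n+2h-2)$; (iii) $G(\overline{\Gamma_{2^h}})=\frac{n(n+2h-2)(n-2h)^2}{2}$; (iv) $WW(\overline{\Gamma_{2^h}})=\frac{n(2n+8h-6)}{4}$; (v) $H(\overline{\Gamma_{2^h}})=\frac{n(n-h-\frac{1}{2})}{2}$; (vi) $H_A(\overline{\Gamma_{2^h}})=n(n-2h)(n-h-\frac{1}{2})$; (vii) $H_M(\overline{\Gamma_{2^h}})=\frac{n(n-h-\frac{1}{2})(n-2h)^2}{2}$; (viii) $T_{AG}(\overline{\Gamma_{2^h}})=\frac{n(n-2h)}{2}$; (ix) $T_{GA}(\overline{\Gamma_{2^h}})=\frac{n(n-2h)}{2}$; (x) $T_{SC}(\overline{\Gamma_{2^h}})=\frac{n(n-2h)}{2\sqrt{2}\sqrt{n+2h-2}}$; (xi) $T_{ABC}(\overline{\Gamma_{2^h}})=\frac{n(n-2h)\sqrt{n+2h-3}}{\sqrt{2}(n+2h-2)}$; (xii) $T_{AZ}(\overline{\Gamma_{2^h}})=\frac{n(n-2h)(n+2h-2)^6}{16(n+2h-3)^3}$; (xiii) $RT_{AG}(\overline{\Gamma_{2^h}})=\frac{n(n-2h)}{2}$;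 (xiv) $RT_{GA}(\overline{\Gamma_{2^h}})=\frac{n(n-2h)}{2}$; (xv) $RT_{SC}(\overline{\Gamma_{2^h}})=\frac{n(n-2h)}{2\sqrt{2n-2h-1}}$; (xvi) $RT_{ABC}(\overline{\Gamma_{2^h}})=\frac{n(n-2h)\sqrt{2n-2h-3}}{2n-2h-1}$; (xvii) $RT_{AZ}(\overline{\Gamma_{2^h}})=\frac{n(2h-n)(1+2h-2n)^6}{128(3+2h-2n)^3}$.
   Context: For $S\subseteq\mathbb{Z}_n\setminus\{0\}$, the circulant graph $C_n(S)$ is the simple undirected graph with vertex set $\mathbb{Z}_n$ and edge set $\{\{g,g+s\}: g\in\mathbb{Z}_n, s\in S\}$ (addition mod $n$); $C_n(s_1,\ldots,s_t)$ means $C_n(\{s_1,\ldots,s_t\})$. $\overline{\Gamma}$ denotes the complement of $\Gamma$. For a connected graph $\Gamma$, let $d(u,v)$ be the shortest-path distance, $\deg(v)$ the degree, $\sigma(v)=\sum_{u\neq v}d(u,v)$ the transmission of $v$, and $rs(v)=\sum_{u\neq v}\frac{1}{d(u,v)}$ the reciprocal transmission of $v$. Below, $\sum_{\{u,v\}}$ is over unordered pairs of distinct vertices and $\sum_{uv\in E}$ is over (undirected) edges of $\Gamma$. The indices are: $W=\sum_{\{u,v\}}d(u,v)$ (Wiener); $WW=\frac12\sum_{\{u,v\}}[d(u,v)+d(u,v)^2]$ (hyper-Wiener); $H=\sum_{\{u,v\}}\frac{1}{d(u,v)}$ (Harary); $S=\sum_{\{u,v\}}[\deg(u)+\deg(v)]d(u,v)$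 (Schultz); $G=\sum_{\{u,v\}}\deg(u)\deg(v)d(u,v)$ (Gutman); $H_A=\sum_{\{u,v\}}\frac{\deg(u)+\deg(v)}{d(u,v)}$ and $H_M=\sum_{\{u,v\}}\frac{\deg(u)\deg(v)}{d(u,v)}$ (additively and multiplicatively weighted Harary); $T_{GA}=\sum_{uv\in E}\frac{2\sqrt{\sigma(u)\sigma(v)}}{\sigma(u)+\sigma(v)}$; $T_{AG}=\sum_{uv\in E}\frac{\sigma(u)+\sigma(v)}{2\sqrt{\sigma(u)\sigma(v)}}$; $T_{SC}=\sum_{uv\in E}\frac{1}{\sqrt{\sigma(u)+\sigma(v)}}$; $T_{ABC}=\sum_{uv\in E}\sqrt{\frac{\sigma(u)+\sigma(v)-2}{\sigma(u)\sigma(v)}}$; $T_{AZ}=\sum_{uv\in E}\left[\frac{\sigma(u)\sigma(v)}{\sigma(u)+\sigma(v)-2}\right]^3$; and $RT_{GA},RT_{AG},RT_{SC},RT_{ABC},RT_{AZ}$ are defined by the same formulas as $T_{GA},T_{AG},T_{SC},T_{ABC},T_{AZ}$ respectively, with $\sigma$ replaced by $rs$. *)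

theory Defs
  imports Complex_Main
begin

text \<open>A simple undirected graph is given by a vertex set and a set of two-element subsets of it.\<close>

record 'a ugraph =
  verts :: "'a set"
  edges :: "'a set set"

definition vertex_pairs :: "'a ugraph \<Rightarrow> 'a set set" where
  "vertex_pairs G = {{u, v} | u v. u \<in> verts G \<and> v \<in> verts G \<and> u \<noteq> v}"

definition simple_graph :: "'a ugraph \<Rightarrow> bool" where
  "simple_graph G \<longleftrightarrow> finite (verts G) \<and> edges G \<subseteq> vertex_pairs G"

definition complement_graph :: "'a ugraph \<Rightarrow> 'a ugraph" where
  "complement_graph G = \<lparr>verts = verts G, edges = vertex_pairs G - edges G\<rparr>"

text \<open>The residues modulo \<open>n\<close> are represented by \<open>0, \<dots>, n - 1\<close>. The connection set is meant to
  satisfy \<open>S \<subseteq> {1..<n}\<close>; otherwise loops may appear. It need not be closed under negation.\<close>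

definition circulant_graph :: "nat \<Rightarrow> nat set \<Rightarrow> nat ugraph" where
  "circulant_graph n S =
     \<lparr>verts = {0..<n}, edges = {{g, (g + s) mod n} | g s. g \<in> {0..<n} \<and> s \<in> S}\<rparr>"

definition is_path :: "'a ugraph \<Rightarrow> 'a \<Rightarrow> 'a list \<Rightarrow> 'a \<Rightarrow> bool" where
  "is_path G u xs v \<longleftrightarrow>
     xs \<noteq> [] \<and> hd xs = u \<and> last xs = v \<and> set xs \<subseteq> verts G \<and> distinct xs \<and>
     successively (\<lambda>x y. {x, y} \<in> edges G) xs"

definition connected_graph :: "'a ugraph \<Rightarrow> bool" where
  "connected_graph G \<longleftrightarrow>
     verts G \<noteq> {} \<and> (\<forall>u\<in>verts G. \<forall>v\<in>verts G. \<exists>xs. is_path G u xs v)"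

text \<open>A path with vertex list \<open>xs\<close> has \<open>length xs - 1\<close> edges. The distance is only meaningful when
  \<open>u\<close> and \<open>v\<close> are joined by a path, so the indices below are only meaningful for connected graphs.\<close>

definition graph_dist :: "'a ugraph \<Rightarrow> 'a \<Rightarrow> 'a \<Rightarrow> nat" where
  "graph_dist G u v = (LEAST k. \<exists>xs. is_path G u xs v \<and> k = length xs - 1)"

definition degree :: "'a ugraph \<Rightarrow> 'a \<Rightarrow> nat" where
  "degree G v = card {e \<in> edges G. v \<in> e}"

definition transmission :: "'a ugraph \<Rightarrow> 'a \<Rightarrow> real" where
  "transmission G v = (\<Sum>u \<in> verts G - {v}. real (graph_dist G u v))"

definition reciprocal_transmission :: "'a ugraph \<Rightarrow> 'a \<Rightarrow> real" where
  "reciprocal_transmission G v = (\<Sum>u \<in> verts G - {v}. 1 / real (graph_dist G u v))"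

text \<open>The value of a symmetric function \<open>f\<close> at an unordered pair. All sums below run over sets of
  two-element sets, so that every unordered pair and every edge contributes once.\<close>

definition on_pair :: "('a \<Rightarrow> 'a \<Rightarrow> real) \<Rightarrow> 'a set \<Rightarrow> real" where
  "on_pair f e = (THE r. \<exists>u v. e = {u, v} \<and> u \<noteq> v \<and> r = f u v)"

lemma on_pair_eq:
  assumes "\<And>x y. f x y = f y x" and "u \<noteq> v"
  shows "on_pair f {u, v} = f u v"
  unfolding on_pair_def using assms by (intro the_equality) (auto simp: doubleton_eq_iff)

definition sum_pairs :: "'a ugraph \<Rightarrow> ('a \<Rightarrow> 'a \<Rightarrow> real) \<Rightarrow> real" where
  "sum_pairs G f = (\<Sum>e \<in> vertex_pairs G. on_pair f e)"

definition sum_edges :: "'a ugraph \<Rightarrow> ('a \<Rightarrow> 'a \<Rightarrow> real) \<Rightarrow> real" where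
  "sum_edges G f = (\<Sum>e \<in> edges G. on_pair f e)"

definition wiener_index :: "'a ugraph \<Rightarrow> real" where
  "wiener_index G = sum_pairs G (\<lambda>u v. real (graph_dist G u v))"

definition hyper_wiener_index :: "'a ugraph \<Rightarrow> real" where
  "hyper_wiener_index G =
     1 / 2 * sum_pairs G (\<lambda>u v. real (graph_dist G u v) + (real (graph_dist G u v))\<^sup>2)"

definition harary_index :: "'a ugraph \<Rightarrow> real" where
  "harary_index G = sum_pairs G (\<lambda>u v. 1 / real (graph_dist G u v))"

definition schultz_index :: "'a ugraph \<Rightarrow> real" where
  "schultz_index G =
     sum_pairs G (\<lambda>u v. (real (degree G u) + real (degree G v)) * real (graph_dist G u v))"

definition gutman_index :: "'a ugraph \<Rightarrow> real" where
  "gutman_index G =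
     sum_pairs G (\<lambda>u v. real (degree G u) * real (degree G v) * real (graph_dist G u v))"

definition additive_harary_index :: "'a ugraph \<Rightarrow> real" where
  "additive_harary_index G =
     sum_pairs G (\<lambda>u v. (real (degree G u) + real (degree G v)) / real (graph_dist G u v))"

definition multiplicative_harary_index :: "'a ugraph \<Rightarrow> real" where
  "multiplicative_harary_index G =
     sum_pairs G (\<lambda>u v. real (degree G u) * real (degree G v) / real (graph_dist G u v))"

text \<open>The edge-sum indices for an arbitrary vertex weight \<open>w\<close>; the weight is \<open>transmission G\<close> for
  the indices \<open>T\<close> and \<open>reciprocal_transmission G\<close> for the indices \<open>RT\<close>.\<close>

definition GA_index :: "'a ugraph \<Rightarrow> ('a \<Rightarrow> real) \<Rightarrow> real" where
  "GA_index G w = sum_edges G (\<lambda>u v. 2 * sqrt (w u * w v) / (w u + w v))"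

definition AG_index :: "'a ugraph \<Rightarrow> ('a \<Rightarrow> real) \<Rightarrow> real" where
  "AG_index G w = sum_edges G (\<lambda>u v. (w u + w v) / (2 * sqrt (w u * w v)))"

definition SC_index :: "'a ugraph \<Rightarrow> ('a \<Rightarrow> real) \<Rightarrow> real" where
  "SC_index G w = sum_edges G (\<lambda>u v. 1 / sqrt (w u + w v))"

definition ABC_index :: "'a ugraph \<Rightarrow> ('a \<Rightarrow> real) \<Rightarrow> real" where
  "ABC_index G w = sum_edges G (\<lambda>u v. sqrt ((w u + w v - 2) / (w u * w v)))"

definition AZ_index :: "'a ugraph \<Rightarrow> ('a \<Rightarrow> real) \<Rightarrow> real" where
  "AZ_index G w = sum_edges G (\<lambda>u v. (w u * w v / (w u + w v - 2)) ^ 3)"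

definition "T_GA G = GA_index G (transmission G)"
definition "T_AG G = AG_index G (transmission G)"
definition "T_SC G = SC_index G (transmission G)"
definition "T_ABC G = ABC_index G (transmission G)"
definition "T_AZ G = AZ_index G (transmission G)"

definition "RT_GA G = GA_index G (reciprocal_transmission G)"
definition "RT_AG G = AG_index G (reciprocal_transmission G)"
definition "RT_SC G = SC_index G (reciprocal_transmission G)"
definition "RT_ABC G = ABC_index G (reciprocal_transmission G)"
definition "RT_AZ G = AZ_index G (reciprocal_transmission G)"

text \<open>The complement of the circulant graph with connection set \<open>1, 2, \<dots>, 2 ^ (h - 1)\<close> is a
  connected simple graph for \<open>h \<ge> 4\<close>, so its distances and indices are meaningful.\<close>

abbreviation pow2_circulant :: "nat \<Rightarrow> nat ugraph" where
  "pow2_circulant h \<equiv> circulant_graph (2 ^ h) {2 ^ i | i. i < h}"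

lemma pow2_connection_set: "{2 ^ i | i. i < h} \<subseteq> {1..<2 ^ h :: nat}"
  by auto

lemma simple_graph_circulant:
  assumes "S \<subseteq> {1..<n}"
  shows "simple_graph (circulant_graph n S)"
proof -
  have "g \<noteq> (g + s) mod n" if "g < n" "s \<in> S" for g s
  proof
    assume "g = (g + s) mod n"
    then have "(g + 0) mod n = (g + s) mod n" using that by simp
    then have "n dvd s" by (metis add.right_neutral mod_eq_dvd_iff_nat diff_add_inverse le_add1)
    then show False using assms that by (fastforce dest: dvd_imp_le)
  qed
  then show ?thesis
    unfolding simple_graph_def vertex_pairs_def circulant_graph_def by force
qed

lemma simple_graph_complement: "simple_graph G \<Longrightarrow> simple_graph (complement_graph G)"
  by (auto simp: simple_graph_def complement_graph_def vertex_pairs_def)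

text \<open>Two vertices are adjacent in the complement iff their difference satisfies the following
  predicate. Every power of two is a sum of two such residues, so the diameter is at most two.\<close>

definition avoids_pow2 :: "nat \<Rightarrow> int \<Rightarrow> bool" where
  "avoids_pow2 h d \<longleftrightarrow>
     \<not> 2 ^ h dvd d \<and> (\<forall>i<h. \<not> 2 ^ h dvd d - 2 ^ i \<and> \<not> 2 ^ h dvd d + 2 ^ i)"

lemma avoids_pow2_uminus: "avoids_pow2 h (- d) \<longleftrightarrow> avoids_pow2 h d"
proof -
  have "(2::int) ^ h dvd - d - 2 ^ i \<longleftrightarrow> 2 ^ h dvd d + 2 ^ i"
    and "(2::int) ^ h dvd - d + 2 ^ i \<longleftrightarrow> 2 ^ h dvd d - 2 ^ i" for i
    by (metis dvd_minus_iff minus_diff_eq diff_minus_eq_add minus_diff_commute,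
        metis dvd_minus_iff minus_diff_eq minus_diff_commute uminus_add_conv_diff)
  then show ?thesis unfolding avoids_pow2_def by (auto simp: dvd_minus_iff)
qed

lemma pow2_mod16: "(2::int) ^ j mod 16 \<in> {0, 1, 2, 4, 8}"
proof (induction j)
  case (Suc j)
  have "(2::int) ^ Suc j mod 16 = (2 * (2 ^ j mod 16)) mod 16" by (simp add: mod_mult_right_eq)
  with Suc show ?case by auto
qed simp

lemma avoids_pow2_mult:
  assumes "a \<in> {3, 5, 6, 7}" and "k + 4 \<le> h"
  shows "avoids_pow2 h (a * 2 ^ k)"
proof -
  have pw: "(2::int) ^ (k + 4) = 2 ^ k * 16" by (simp add: power_add)
  have red: "\<not> (2::int) ^ h dvd x" if "\<not> 2 ^ k * 16 dvd x" for x
    using that assms(2) by (metis pw dvd_trans le_imp_power_dvd)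
  have no: "\<not> 16 dvd a" using assms(1) by auto
  have c: "\<not> 16 dvd a - 2 ^ j" "\<not> 16 dvd a + 2 ^ j" for j
    using assms(1) pow2_mod16[of j] by (auto; presburger)+
  have d: "\<not> (2::int) ^ k * 16 dvd a * 2 ^ k - 2 ^ i \<and> \<not> 2 ^ k * 16 dvd a * 2 ^ k + 2 ^ i" for i
  proof (cases "k \<le> i")
    case True
    then obtain j where "i = k + j" using le_Suc_ex by blast
    then have "a * 2 ^ k - 2 ^ i = 2 ^ k * (a - 2 ^ j)" "a * 2 ^ k + 2 ^ i = 2 ^ k * (a + 2 ^ j)"
      by (simp_all add: power_add algebra_simps)
    with c[of j] show ?thesis by simp
  next
    case False
    then have "\<not> (2::int) ^ k dvd 2 ^ i" using zdvd_imp_le[of "2 ^ k" "2 ^ i"] by auto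
    moreover have "(2::int) ^ k dvd 2 ^ i" if "2 ^ k * 16 dvd a * 2 ^ k - 2 ^ i"
      using dvd_diff[OF dvd_triv_right dvd_mult_left[OF that], of a] by simp
    moreover have "(2::int) ^ k dvd 2 ^ i" if "2 ^ k * 16 dvd a * 2 ^ k + 2 ^ i"
      using dvd_diff[OF dvd_mult_left[OF that] dvd_triv_right, of a] by simp
    ultimately show ?thesis by blast
  qed
  have "\<not> 2 ^ k * 16 dvd a * 2 ^ k" using no by (simp add: mult.commute)
  with d red show ?thesis unfolding avoids_pow2_def by blast
qed

lemma pow2_decomposition:
  assumes "h \<ge> 4" and "i < h"
  shows "\<exists>a. avoids_pow2 h a \<and> avoids_pow2 h (2 ^ i - a)"
proof -
  have A: "avoids_pow2 h b" if "b \<in> {3, 5, 6, 7}" for b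
    using avoids_pow2_mult[OF that, of 0 h] assms(1) by simp
  have *: ?thesis if "b \<in> {3, 5, 6, 7}" "c \<in> {3, 5, 6, 7}" "2 ^ i - b = - c" for b c :: int
    using that(3) A[OF that(1)] A[OF that(2)] avoids_pow2_uminus[of h c] by (intro exI[of _ b]) simp
  have "i = 0 \<or> i = 1 \<or> i = 2 \<or> (\<exists>k. i = k + 3)" by presburger
  then consider "i = 0" | "i = 1" | "i = 2" | k where "i = k + 3" by blast
  then show ?thesis
  proof cases
    case 4
    have "avoids_pow2 h (3 * 2 ^ k)" "avoids_pow2 h (5 * 2 ^ k)"
      using 4 assms by (auto intro!: avoids_pow2_mult)
    moreover have "(2::int) ^ i - 3 * 2 ^ k = 5 * 2 ^ k" using 4 by (simp add: power_add)
    ultimately show ?thesis by metis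
  qed (use *[of 6 5] *[of 5 3] *[of 7 3] in auto)
qed

lemma adjacent_complement_pow2:
  assumes "x < 2 ^ h" and "y < 2 ^ h" and "avoids_pow2 h (int y - int x)"
  shows "{x, y} \<in> edges (complement_graph (pow2_circulant h))"
proof -
  have no: False if "z = (g + 2 ^ i) mod 2 ^ h" "i < h" "int z - int g = d" "avoids_pow2 h d"
    for z g i :: nat and d
  proof -
    have "int z = (int g + 2 ^ i) mod 2 ^ h" using that(1) by (simp add: zmod_int)
    then have "(2::int) ^ h dvd (int g + 2 ^ i) - int z" by (metis dvd_minus_mod)
    then have "(2::int) ^ h dvd d - 2 ^ i"
      using that(3) by (metis diff_diff_eq2 diff_diff_add dvd_diff_commute add.commute)
    then show False using that(2,4) unfolding avoids_pow2_def by blast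
  qed
  have "{x, y} \<noteq> {g, (g + 2 ^ i) mod 2 ^ h}" if "i < h" for g i
    using no[of y x i] no[of x y i] that assms(3) avoids_pow2_uminus[of h "int y - int x"]
    by (auto simp: doubleton_eq_iff)
  moreover have "x \<noteq> y" using assms(3) unfolding avoids_pow2_def by auto
  ultimately show ?thesis
    using assms(1,2) unfolding complement_graph_def vertex_pairs_def circulant_graph_def by auto
qed

lemma connected_complement_pow2:
  assumes "h \<ge> 4"
  shows "connected_graph (complement_graph (pow2_circulant h))"
proof -
  let ?G = "complement_graph (pow2_circulant h)"
  have V: "verts ?G = {0..<2 ^ h}" by (simp add: complement_graph_def circulant_graph_def)
  have mid: "\<exists>w \<in> verts ?G. {g, w} \<in> edges ?G \<and> {w, (g + 2 ^ i) mod 2 ^ h} \<in> edges ?G"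
    if gi: "g < 2 ^ h" "i < h" for g i
  proof -
    obtain a where a: "avoids_pow2 h a" "avoids_pow2 h (2 ^ i - a)"
      using pow2_decomposition[OF assms gi(2)] by blast
    define w where "w = nat ((int g + a) mod 2 ^ h)"
    have w: "int w = (int g + a) mod 2 ^ h" unfolding w_def by simp
    then have "int w < 2 ^ h" by simp
    then have wV: "w < 2 ^ h" by (metis of_nat_less_numeral_power_cancel_iff of_nat_numeral)
    have inv: "avoids_pow2 h d" if "avoids_pow2 h c" "2 ^ h dvd d - c" for c d
    proof -
      have "2 ^ h dvd d + e \<longleftrightarrow> 2 ^ h dvd c + e" for e :: int
        using dvd_add_right_iff[OF that(2), of "c + e"] by simp
      from this[of 0] this this[of "- (2 ^ _)"] show ?thesis
        using that(1) unfolding avoids_pow2_def by simp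
    qed
    have g1: "(2::int) ^ h dvd (int w - int g) - a"
      using w by (metis diff_diff_add dvd_diff_commute dvd_minus_mod)
    have "int ((g + 2 ^ i) mod 2 ^ h) = (int g + 2 ^ i) mod 2 ^ h" by (simp add: zmod_int)
    then have "(2::int) ^ h dvd int ((g + 2 ^ i) mod 2 ^ h) - (int g + 2 ^ i)"
      by (metis dvd_diff_commute dvd_minus_mod)
    from dvd_diff[OF this g1]
    have "(2::int) ^ h dvd (int ((g + 2 ^ i) mod 2 ^ h) - int w) - (2 ^ i - a)"
      by (simp add: algebra_simps)
    then show ?thesis
      using adjacent_complement_pow2[OF gi(1) wV inv[OF a(1) g1]]
        adjacent_complement_pow2[OF wV _ inv[OF a(2)]] wV V by auto
  qed
  have "\<exists>xs. is_path ?G u xs v" if "u \<in> verts ?G" "v \<in> verts ?G" for u v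
  proof (cases "u = v \<or> {u, v} \<in> edges ?G")
    case True
    then show ?thesis
    proof
      assume "u = v"
      then have "is_path ?G u [u] v" using that by (simp add: is_path_def)
      then show ?thesis ..
    next
      assume e: "{u, v} \<in> edges ?G"
      then have "u \<noteq> v" by (auto simp: complement_graph_def vertex_pairs_def)
      then have "is_path ?G u [u, v] v" using that e by (simp add: is_path_def)
      then show ?thesis ..
    qed
  next
    case False
    then have "{u, v} \<in> edges (pow2_circulant h)"
      using that by (auto simp: complement_graph_def vertex_pairs_def)
    then obtain g i where gi: "{u, v} = {g, (g + 2 ^ i) mod 2 ^ h}" "g < 2 ^ h" "i < h"
      by (auto simp: circulant_graph_def)
    obtain w where w: "w \<in> verts ?G" "{g, w} \<in> edges ?G" "{w, (g + 2 ^ i) mod 2 ^ h} \<in> edges ?G"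
      using mid gi by blast
    then have "{u, w} \<in> edges ?G \<and> {w, v} \<in> edges ?G"
      using gi(1) by (auto simp: doubleton_eq_iff insert_commute)
    moreover from this have "u \<noteq> w \<and> w \<noteq> v"
      by (auto simp: complement_graph_def vertex_pairs_def)
    ultimately have "is_path ?G u [u, w, v] v" using that w False by (simp add: is_path_def)
    then show ?thesis ..
  qed
  then show ?thesis unfolding connected_graph_def using V by auto
qed

end

theory Submission
  imports Defs
begin

text \<open>
  Every index in the theorem is determined by three features of the graph: the order \<open>N\<close>, the
  fact that it is regular of some degree \<open>d\<close>, and the fact that any two distinct non-adjacent
  vertices have a common neighbour. In such a graph a vertex sees \<open>d\<close> vertices at distance 1 and
  the remaining \<open>N - 1 - d\<close> at distance 2, so a sum of \<open>g (graph_dist G u v)\<close> over all pairs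
  equals \<open>N * (d * g 1 + (N - 1 - d) * g 2) / 2\<close>; moreover the transmissions and the reciprocal
  transmissions are constant, so an edge sum is \<open>N * d / 2\<close> times a single summand. The locale
  \<open>regular_diameter_two\<close> derives the indices at this level.

  It remains to identify \<open>d\<close> and to check the diameter. In a circulant graph the degree is the
  number of residues of the form \<open>s\<close> or \<open>- s\<close> with \<open>s\<close> in the connection set. For the powers of
  two below \<open>2 ^ h\<close> the only residue counted twice is \<open>2 ^ (h - 1)\<close>, its own negative; this gives
  \<open>2 * h - 1\<close>, hence \<open>d = 2 ^ h - 2 * h\<close> in the complement. The common neighbours then come from
  counting: since \<open>4 * h \<le> 2 ^ h\<close> for \<open>h \<ge> 4\<close>, two neighbourhoods of size \<open>d\<close> cannot be disjoint
  inside the \<open>2 ^ h - 2\<close> vertices other than two given non-adjacent ones.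
\<close>

section \<open>Neighbourhoods, degrees and edge counts\<close>

lemma vertex_pairs_altdef: "vertex_pairs G = {e. e \<subseteq> verts G \<and> card e = 2}"
  by (auto simp: vertex_pairs_def card_2_iff)

lemma vertex_pairsE:
  assumes "e \<in> vertex_pairs G"
  obtains u v where "e = {u, v}" and "u \<in> verts G" and "v \<in> verts G" and "u \<noteq> v"
  using assms unfolding vertex_pairs_def by blast

lemma simple_graph_finite_vertex_pairs: "simple_graph G \<Longrightarrow> finite (vertex_pairs G)"
  unfolding vertex_pairs_altdef simple_graph_def by simp

lemma simple_graph_finite_edges: "simple_graph G \<Longrightarrow> finite (edges G)"
  using simple_graph_finite_vertex_pairs finite_subset unfolding simple_graph_def by blast

lemma simple_graph_edgeD:
  assumes "simple_graph G" and "{u, v} \<in> edges G"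
  shows "u \<in> verts G" and "v \<in> verts G" and "u \<noteq> v"
proof -
  have "{u, v} \<in> vertex_pairs G" using assms unfolding simple_graph_def by blast
  then show "u \<in> verts G" "v \<in> verts G" "u \<noteq> v"
    by (auto simp: vertex_pairs_def doubleton_eq_iff)
qed

lemma pairs_containing_eq_image:
  assumes "E \<subseteq> vertex_pairs G"
  shows "{e \<in> E. v \<in> e} = (\<lambda>u. {v, u}) ` {u \<in> verts G. {v, u} \<in> E}"
proof
  show "{e \<in> E. v \<in> e} \<subseteq> (\<lambda>u. {v, u}) ` {u \<in> verts G. {v, u} \<in> E}"
  proof
    fix e assume "e \<in> {e \<in> E. v \<in> e}"
    then have e: "e \<in> E" "v \<in> e" by auto
    then obtain a b where ab: "e = {a, b}" "a \<in> verts G" "b \<in> verts G"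
      using assms by (blast elim: vertex_pairsE)
    then have "\<exists>u \<in> verts G. e = {v, u}" using e(2) by auto
    then show "e \<in> (\<lambda>u. {v, u}) ` {u \<in> verts G. {v, u} \<in> E}" using e(1) by blast
  qed
qed auto

lemma card_pairs_containing:
  assumes "E \<subseteq> vertex_pairs G"
  shows "card {e \<in> E. v \<in> e} = card {u \<in> verts G. {v, u} \<in> E}"
  unfolding pairs_containing_eq_image[OF assms]
  by (intro card_image inj_onI) (auto simp: doubleton_eq_iff)

lemma degree_eq_card_neighbours:
  "simple_graph G \<Longrightarrow> degree G v = card {u \<in> verts G. {v, u} \<in> edges G}"
  unfolding degree_def simple_graph_def by (intro card_pairs_containing) simp

lemma degree_complement:
  assumes "simple_graph G" and "v \<in> verts G"
  shows "degree (complement_graph G) v = card (verts G) - 1 - degree G v"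
proof -
  have E: "edges G \<subseteq> vertex_pairs G" using assms(1) by (simp add: simple_graph_def)
  have "{u \<in> verts G. {v, u} \<in> vertex_pairs G} = verts G - {v}"
    using assms(2) by (auto simp: vertex_pairs_def doubleton_eq_iff)
  then have all: "card {e \<in> vertex_pairs G. v \<in> e} = card (verts G) - 1"
    using card_pairs_containing[of "vertex_pairs G" G v] assms by (simp add: simple_graph_def)
  have split: "{e \<in> edges (complement_graph G). v \<in> e}
      = {e \<in> vertex_pairs G. v \<in> e} - {e \<in> edges G. v \<in> e}"
    by (auto simp: complement_graph_def)
  have "finite {e \<in> edges G. v \<in> e}"
    using simple_graph_finite_edges[OF assms(1)] by simp
  moreover have "{e \<in> edges G. v \<in> e} \<subseteq> {e \<in> vertex_pairs G. v \<in> e}" using E by blast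
  ultimately show ?thesis unfolding degree_def split all[symmetric] by (rule card_Diff_subset)
qed

text \<open>The neighbourhoods of \<open>u\<close> and \<open>v\<close> both lie in the vertex set without \<open>u\<close> and \<open>v\<close>, which is
  too small to contain them disjointly.\<close>

lemma common_neighbour_if_large_degrees:
  assumes G: "simple_graph G" and uv: "u \<in> verts G" "v \<in> verts G" "u \<noteq> v" "{u, v} \<notin> edges G"
    and large: "card (verts G) < degree G u + degree G v + 2"
  shows "\<exists>w. {u, w} \<in> edges G \<and> {w, v} \<in> edges G"
proof (rule ccontr)
  assume no: "\<nexists>w. {u, w} \<in> edges G \<and> {w, v} \<in> edges G"
  define N where "N x = {w \<in> verts G. {x, w} \<in> edges G}" for x
  have fin: "finite (verts G)" using G by (simp add: simple_graph_def)
  have "N u \<inter> N v = {}" using no by (auto simp: N_def insert_commute)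
  then have "card (N u) + card (N v) = card (N u \<union> N v)"
    using fin by (intro card_Un_disjoint[symmetric]) (auto simp: N_def)
  also have "\<dots> \<le> card (verts G - {u, v})"
    using fin uv simple_graph_edgeD(3)[OF G]
    by (intro card_mono) (auto simp: N_def insert_commute)
  also have "\<dots> = card (verts G) - 2" using fin uv by (simp add: card_Diff_subset)
  finally have "degree G u + degree G v \<le> card (verts G) - 2"
    by (simp add: degree_eq_card_neighbours[OF G] N_def)
  moreover have "card {u, v} \<le> card (verts G)" using fin uv by (intro card_mono) auto
  ultimately show False using large uv by simp
qed

section \<open>Distances one and two\<close>

lemma graph_dist_le:
  "is_path G u xs v \<Longrightarrow> graph_dist G u v \<le> length xs - 1"
  unfolding graph_dist_def by (rule Least_le) auto

lemma graph_dist_attained: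
  assumes "is_path G u xs v"
  obtains ys where "is_path G u ys v" and "graph_dist G u v = length ys - 1"
  using LeastI_ex[of "\<lambda>k. \<exists>xs. is_path G u xs v \<and> k = length xs - 1"] assms
  unfolding graph_dist_def by blast

lemma is_path_length_ge_2:
  assumes "is_path G u xs v" and "u \<noteq> v"
  shows "length xs \<ge> 2"
proof (rule ccontr)
  assume "\<not> length xs \<ge> 2"
  moreover have "xs \<noteq> []" using assms(1) by (simp add: is_path_def)
  ultimately have "length xs = Suc 0" by (cases xs) (simp_all add: not_le)
  then obtain a where "xs = [a]" by (auto simp: length_Suc_conv)
  then show False using assms by (auto simp: is_path_def)
qed

lemma is_path_length_ge_3:
  assumes "is_path G u xs v" and "u \<noteq> v" and "{u, v} \<notin> edges G"
  shows "length xs \<ge> 3"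
proof (rule ccontr)
  assume "\<not> length xs \<ge> 3"
  then have "length xs = Suc (Suc 0)" using is_path_length_ge_2[OF assms(1,2)] by simp
  then obtain a b where "xs = [a, b]" by (auto simp: length_Suc_conv)
  then show False using assms by (auto simp: is_path_def)
qed

lemma graph_dist_adjacent:
  assumes G: "simple_graph G" and e: "{u, v} \<in> edges G"
  shows "graph_dist G u v = 1"
proof -
  note D = simple_graph_edgeD[OF G e]
  have p: "is_path G u [u, v] v" using D e by (simp add: is_path_def)
  obtain ys where "is_path G u ys v" "graph_dist G u v = length ys - 1"
    using graph_dist_attained[OF p] .
  then show ?thesis using is_path_length_ge_2[of G u ys v] D graph_dist_le[OF p] by simp
qed

lemma graph_dist_common_neighbour:
  assumes G: "simple_graph G" and uv: "u \<noteq> v" "{u, v} \<notin> edges G"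
    and w: "{u, w} \<in> edges G" "{w, v} \<in> edges G"
  shows "graph_dist G u v = 2"
proof -
  have p: "is_path G u [u, w, v] v"
    using uv w simple_graph_edgeD[OF G w(1)] simple_graph_edgeD[OF G w(2)]
    by (simp add: is_path_def)
  obtain ys where "is_path G u ys v" "graph_dist G u v = length ys - 1"
    using graph_dist_attained[OF p] .
  then show ?thesis using is_path_length_ge_3[of G u ys v] uv graph_dist_le[OF p] by simp
qed

section \<open>Regular graphs of diameter two\<close>

text \<open>Constancy of \<open>f\<close> in both orders of the pair takes the place of symmetry, so that weights
  need only be controlled on the vertices of the graph.\<close>

lemma on_pair_const:
  assumes "a \<noteq> b" and "f a b = c" and "f b a = c"
  shows "on_pair f {a, b} = c"
  unfolding on_pair_def using assms by (intro the_equality) (auto simp: doubleton_eq_iff)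

locale regular_diameter_two =
  fixes G :: "'a ugraph" and d N :: nat
  assumes simple: "simple_graph G"
    and card_verts: "card (verts G) = N"
    and regular: "v \<in> verts G \<Longrightarrow> degree G v = d"
    and common_neighbour:
      "u \<in> verts G \<Longrightarrow> v \<in> verts G \<Longrightarrow> u \<noteq> v \<Longrightarrow> {u, v} \<notin> edges G \<Longrightarrow>
        \<exists>w. {u, w} \<in> edges G \<and> {w, v} \<in> edges G"
begin

lemma dist_eq:
  assumes "u \<in> verts G" "v \<in> verts G" "u \<noteq> v"
  shows "graph_dist G u v = (if {u, v} \<in> edges G then 1 else 2)"
  using graph_dist_adjacent[OF simple] graph_dist_common_neighbour[OF simple]
    common_neighbour[OF assms] assms(3) by auto

text \<open>The handshake count: every edge is counted at its two ends.\<close>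

lemma card_edges: "real (card (edges G)) = real N * real d / 2"
proof -
  have "(\<Sum>v \<in> verts G. card {e \<in> edges G. v \<in> e}) = 2 * card (edges G)"
  proof (rule sum_multicount)
    show "\<forall>e \<in> edges G. card {v \<in> verts G. v \<in> e} = 2"
    proof
      fix e assume "e \<in> edges G"
      then have "e \<subseteq> verts G" "card e = 2"
        using simple by (auto simp: simple_graph_def vertex_pairs_altdef)
      moreover from this have "{v \<in> verts G. v \<in> e} = e" by blast
      ultimately show "card {v \<in> verts G. v \<in> e} = 2" by simp
    qed
  qed (use simple simple_graph_finite_edges in \<open>auto simp: simple_graph_def\<close>)
  moreover have "(\<Sum>v \<in> verts G. card {e \<in> edges G. v \<in> e}) = N * d"
    using regular card_verts by (simp add: degree_def)
  ultimately have "real (N * d) = real (2 * card (edges G))" by simp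
  then show ?thesis by simp
qed

lemma card_vertex_pairs: "real (card (vertex_pairs G)) = real N * (real N - 1) / 2"
proof -
  have "card (vertex_pairs G) = N choose 2"
    using simple card_verts
    by (simp add: vertex_pairs_altdef simple_graph_def n_subsets)
  moreover have "2 * (N choose 2) = N * (N - 1)"
    unfolding choose_two by (rule dvd_mult_div_cancel) (cases N; simp)
  ultimately have "real (2 * card (vertex_pairs G)) = real (N * (N - 1))" by simp
  then show ?thesis by (cases N) (simp_all add: field_simps)
qed

lemma sum_pairs_dist:
  assumes f: "\<And>u v. u \<in> verts G \<Longrightarrow> v \<in> verts G \<Longrightarrow> u \<noteq> v \<Longrightarrow> f u v = g (graph_dist G u v)"
  shows "sum_pairs G f = real N * (real d * g 1 + (real N - 1 - real d) * g 2) / 2"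
proof -
  have E: "edges G \<subseteq> vertex_pairs G" and fin: "finite (vertex_pairs G)"
    using simple simple_graph_finite_vertex_pairs by (auto simp: simple_graph_def)
  have pair: "on_pair f e = (if e \<in> edges G then g 1 else g 2)" if "e \<in> vertex_pairs G" for e
  proof -
    obtain a b where ab: "e = {a, b}" "a \<in> verts G" "b \<in> verts G" "a \<noteq> b"
      using \<open>e \<in> vertex_pairs G\<close> by (rule vertex_pairsE)
    have "graph_dist G b a = graph_dist G a b"
      using ab dist_eq by (metis insert_commute)
    then show ?thesis
      unfolding ab(1) using ab(2-4) by (intro on_pair_const) (simp_all add: f dist_eq)
  qed
  have "sum_pairs G f
      = (\<Sum>e \<in> edges G. on_pair f e) + (\<Sum>e \<in> vertex_pairs G - edges G. on_pair f e)"
    unfolding sum_pairs_def by (subst sum.subset_diff[OF E fin]) simp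
  also have "(\<Sum>e \<in> edges G. on_pair f e) = real (card (edges G)) * g 1"
    using pair E by (simp add: subset_iff)
  also have "(\<Sum>e \<in> vertex_pairs G - edges G. on_pair f e)
      = real (card (vertex_pairs G - edges G)) * g 2"
    using pair by simp
  also have "real (card (vertex_pairs G - edges G))
      = real (card (vertex_pairs G)) - real (card (edges G))"
    using card_Diff_subset[OF finite_subset[OF E fin] E] card_mono[OF fin E] by simp
  finally show ?thesis unfolding card_edges card_vertex_pairs by (simp add: field_simps)
qed

lemma sum_dist_from_vertex:
  assumes v: "v \<in> verts G"
  shows "(\<Sum>u \<in> verts G - {v}. g (graph_dist G u v))
    = real d * g 1 + (real N - 1 - real d) * g 2"
proof -
  define A where "A = {u \<in> verts G. {v, u} \<in> edges G}"
  have fin: "finite (verts G)" using simple by (simp add: simple_graph_def)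
  have A: "A \<subseteq> verts G - {v}" using simple_graph_edgeD(3)[OF simple] by (auto simp: A_def)
  have cA: "card A = d"
    using regular[OF v] degree_eq_card_neighbours[OF simple] by (simp add: A_def)
  have cV: "real (card (verts G - {v})) = real N - 1"
    using fin v card_verts card_gt_0_iff[of "verts G"] by (auto simp: Suc_le_eq)
  have "(\<Sum>u \<in> verts G - {v}. g (graph_dist G u v))
      = (\<Sum>u \<in> A. g (graph_dist G u v)) + (\<Sum>u \<in> verts G - {v} - A. g (graph_dist G u v))"
    using fin by (subst sum.subset_diff[OF A]) simp_all
  also have "(\<Sum>u \<in> A. g (graph_dist G u v)) = real d * g 1"
  proof -
    have "graph_dist G u v = 1" if "u \<in> A" for u
      using that A v dist_eq[of u v] by (auto simp: A_def insert_commute)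
    then show ?thesis using cA by simp
  qed
  also have "(\<Sum>u \<in> verts G - {v} - A. g (graph_dist G u v))
      = real (card (verts G - {v} - A)) * g 2"
  proof -
    have "graph_dist G u v = 2" if "u \<in> verts G - {v} - A" for u
      using that v dist_eq[of u v] by (auto simp: A_def insert_commute)
    then show ?thesis by simp
  qed
  also have "real (card (verts G - {v} - A)) = real (card (verts G - {v})) - real (card A)"
    using card_Diff_subset[OF finite_subset[OF A] A] card_mono[OF _ A] fin by simp
  finally show ?thesis by (simp only: cA cV)
qed

lemma transmission_eq:
  "v \<in> verts G \<Longrightarrow> transmission G v = 2 * real N - 2 - real d"
  unfolding transmission_def using sum_dist_from_vertex[of v real] by simp

lemma reciprocal_transmission_eq:
  "v \<in> verts G \<Longrightarrow> reciprocal_transmission G v = (real N - 1 + real d) / 2"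
  unfolding reciprocal_transmission_def using sum_dist_from_vertex[of v "\<lambda>k. 1 / real k"]
  by (simp add: field_simps)

lemma sum_edges_const:
  assumes "\<And>u v. u \<in> verts G \<Longrightarrow> v \<in> verts G \<Longrightarrow> f u v = c"
  shows "sum_edges G f = real N * real d / 2 * c"
proof -
  have "on_pair f e = c" if "e \<in> edges G" for e
  proof -
    have "e \<in> vertex_pairs G" using that simple by (auto simp: simple_graph_def)
    then obtain a b where ab: "e = {a, b}" "a \<in> verts G" "b \<in> verts G" "a \<noteq> b"
      by (rule vertex_pairsE)
    show ?thesis unfolding ab(1) using ab(2-4) assms by (intro on_pair_const) simp_all
  qed
  then show ?thesis unfolding sum_edges_def by (simp add: card_edges)
qed

text \<open>On the vertex set all degrees equal \<open>d\<close>, so each summand is a function of the distance alone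
  and \<open>sum_pairs_dist\<close> applies.\<close>

lemma distance_indices:
  shows "wiener_index G = real N * (2 * real N - 2 - real d) / 2"
    and "schultz_index G = real N * real d * (2 * real N - 2 - real d)"
    and "gutman_index G = real N * (2 * real N - 2 - real d) * (real d)\<^sup>2 / 2"
    and "hyper_wiener_index G = real N * (6 * real N - 6 - 4 * real d) / 4"
    and "harary_index G = real N * ((real N - 1 + real d) / 2) / 2"
    and "additive_harary_index G = real N * real d * ((real N - 1 + real d) / 2)"
    and "multiplicative_harary_index G = real N * ((real N - 1 + real d) / 2) * (real d)\<^sup>2 / 2"
  unfolding wiener_index_def schultz_index_def gutman_index_def hyper_wiener_index_def
    harary_index_def additive_harary_index_def multiplicative_harary_index_def
  using sum_pairs_dist[of "\<lambda>u v. real (graph_dist G u v)" real]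
    sum_pairs_dist[of "\<lambda>u v. (real (degree G u) + real (degree G v)) * real (graph_dist G u v)"
      "\<lambda>k. (real d + real d) * real k"]
    sum_pairs_dist[of "\<lambda>u v. real (degree G u) * real (degree G v) * real (graph_dist G u v)"
      "\<lambda>k. real d * real d * real k"]
    sum_pairs_dist[of "\<lambda>u v. real (graph_dist G u v) + (real (graph_dist G u v))\<^sup>2"
      "\<lambda>k. real k + (real k)\<^sup>2"]
    sum_pairs_dist[of "\<lambda>u v. 1 / real (graph_dist G u v)" "\<lambda>k. 1 / real k"]
    sum_pairs_dist[of "\<lambda>u v. (real (degree G u) + real (degree G v)) / real (graph_dist G u v)"
      "\<lambda>k. (real d + real d) / real k"]
    sum_pairs_dist[of "\<lambda>u v. real (degree G u) * real (degree G v) / real (graph_dist G u v)"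
      "\<lambda>k. real d * real d / real k"]
  by (simp_all add: regular field_simps power2_eq_square)

lemma edge_indices_constant_weight:
  assumes w: "\<forall>v \<in> verts G. w v = c" and c: "c > 1"
  shows "AG_index G w = real N * real d / 2"
    and "GA_index G w = real N * real d / 2"
    and "SC_index G w = real N * real d / 2 * (1 / sqrt (2 * c))"
    and "ABC_index G w = real N * real d / 2 * (sqrt (2 * c - 2) / c)"
    and "AZ_index G w = real N * real d / 2 * (c\<^sup>2 / (2 * c - 2)) ^ 3"
proof -
  have r: "\<bar>c\<bar> = c" using c by simp
  show "AG_index G w = real N * real d / 2"
    unfolding AG_index_def using c by (subst sum_edges_const[where c = 1]) (simp_all add: w r)
  show "GA_index G w = real N * real d / 2"
    unfolding GA_index_def using c by (subst sum_edges_const[where c = 1]) (simp_all add: w r)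
  show "SC_index G w = real N * real d / 2 * (1 / sqrt (2 * c))"
    unfolding SC_index_def by (rule sum_edges_const) (simp add: w)
  show "ABC_index G w = real N * real d / 2 * (sqrt (2 * c - 2) / c)"
    unfolding ABC_index_def by (rule sum_edges_const) (simp add: w real_sqrt_divide r)
  show "AZ_index G w = real N * real d / 2 * (c\<^sup>2 / (2 * c - 2)) ^ 3"
    unfolding AZ_index_def by (rule sum_edges_const) (simp add: w power2_eq_square)
qed

end

section \<open>Degrees of circulant graphs\<close>

text \<open>A neighbour of \<open>v\<close> is \<open>v + s\<close> or \<open>v - s\<close> for some \<open>s\<close> in the connection set, and \<open>n - s\<close>
  represents \<open>- s\<close>; adding \<open>v\<close> is injective on residues.\<close>

lemma degree_circulant:
  assumes S: "S \<subseteq> {1..<n}" and v: "v < n"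
  shows "degree (circulant_graph n S) v = card (S \<union> (\<lambda>s. n - s) ` S)"
proof -
  let ?D = "S \<union> (\<lambda>s. n - s) ` S"
  have "{e \<in> edges (circulant_graph n S). v \<in> e} = (\<lambda>d. {v, (v + d) mod n}) ` ?D"
  proof (intro equalityI subsetI)
    fix e assume "e \<in> {e \<in> edges (circulant_graph n S). v \<in> e}"
    then obtain g s where e: "e = {g, (g + s) mod n}" "g < n" "s \<in> S" "v \<in> e"
      by (auto simp: circulant_graph_def)
    then consider "v = g" | "v = (g + s) mod n" by blast
    then show "e \<in> (\<lambda>d. {v, (v + d) mod n}) ` ?D"
    proof cases
      case 2
      have "s \<le> n" using S e(3) by auto
      then have "(v + (n - s)) mod n = (g + n) mod n"
        unfolding 2 mod_add_left_eq by simp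
      then have "e = {v, (v + (n - s)) mod n}" using e 2 by auto
      then show ?thesis using e(3) by auto
    qed (use e in auto)
  next
    fix e assume "e \<in> (\<lambda>d. {v, (v + d) mod n}) ` ?D"
    then obtain s where s: "s \<in> S"
      and "e = {v, (v + s) mod n} \<or> e = {v, (v + (n - s)) mod n}" by blast
    then consider "e = {v, (v + s) mod n}" | "e = {v, (v + (n - s)) mod n}" by blast
    then show "e \<in> {e \<in> edges (circulant_graph n S). v \<in> e}"
    proof cases
      case 1
      then show ?thesis using s v by (auto simp: circulant_graph_def)
    next
      case 2
      define g where "g = (v + (n - s)) mod n"
      have "s \<le> n" using S s by auto
      then have "(g + s) mod n = v" unfolding g_def mod_add_left_eq using v by simp
      moreover have "g < n" using v by (simp add: g_def)
      ultimately have "{g, v} \<in> edges (circulant_graph n S)"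
        using s unfolding circulant_graph_def by force
      then show ?thesis using 2 by (simp add: g_def insert_commute)
    qed
  qed
  moreover have "inj_on (\<lambda>d. {v, (v + d) mod n}) ?D"
  proof (rule inj_onI)
    fix d d' assume d: "d \<in> ?D" "d' \<in> ?D" and "{v, (v + d) mod n} = {v, (v + d') mod n}"
    then have eq: "(v + d) mod n = (v + d') mod n" by (auto simp: doubleton_eq_iff)
    have "d < n" "d' < n" using d S by force+
    moreover have "d mod n = d' mod n" using eq by (simp add: nat_mod_eq_iff)
    ultimately show "d = d'" by simp
  qed
  ultimately show ?thesis unfolding degree_def by (simp add: card_image)
qed

section \<open>The complement of the power-of-two circulant graph\<close>

text \<open>The negative of a power of two below \<open>2 ^ h\<close> is again such a power only if both are
  \<open>2 ^ (h - 1)\<close>: otherwise their sum is too small.\<close>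

lemma card_pow2_and_negatives:
  fixes h :: nat
  assumes "h \<ge> 1"
  defines "S \<equiv> {2 ^ i | i. i < h} :: nat set"
  shows "card (S \<union> (\<lambda>s. 2 ^ h - s) ` S) = 2 * h - 1"
proof -
  have S: "S = (\<lambda>i. 2 ^ i) ` {..<h}" by (auto simp: S_def)
  have fin: "finite S" by (simp add: S)
  have cS: "card S = h" unfolding S by (subst card_image) (auto intro: inj_onI)
  have half: "s \<le> 2 ^ (h - 1)" if "s \<in> S" for s
    using that by (auto simp: S_def)
  have dbl: "(2::nat) ^ h = 2 * 2 ^ (h - 1)" using assms(1) by (cases h) auto
  have cN: "card ((\<lambda>s. 2 ^ h - s) ` S) = h"
  proof (subst card_image)
    show "inj_on (\<lambda>s. 2 ^ h - s) S"
    proof (rule inj_onI)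
      fix s t assume "s \<in> S" "t \<in> S" "2 ^ h - s = 2 ^ h - t"
      then show "s = t" using half[of s] half[of t] dbl by linarith
    qed
  qed (rule cS)
  have "S \<inter> (\<lambda>s. 2 ^ h - s) ` S = {2 ^ (h - 1)}"
  proof (intro equalityI subsetI)
    fix s assume "s \<in> S \<inter> (\<lambda>s. 2 ^ h - s) ` S"
    then obtain t where t: "s \<in> S" "t \<in> S" "s = 2 ^ h - t" by blast
    then have "s = 2 ^ (h - 1)" using half[of s] half[of t] dbl by linarith
    then show "s \<in> {2 ^ (h - 1)}" by simp
  next
    fix s :: nat assume "s \<in> {2 ^ (h - 1)}"
    then have "s = 2 ^ (h - 1)" "s = 2 ^ h - s" using dbl by auto
    moreover have "2 ^ (h - 1) \<in> S" using assms(1) by (auto simp: S_def)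
    ultimately show "s \<in> S \<inter> (\<lambda>s. 2 ^ h - s) ` S" by blast
  qed
  then show ?thesis
    using card_Un_Int[OF fin, of "(\<lambda>s. 2 ^ h - s) ` S"] fin cS cN by simp
qed

lemma four_times_le_pow2: "h \<ge> 4 \<Longrightarrow> 4 * h \<le> (2::nat) ^ h"
  by (induction h rule: nat_induct_at_least) auto

text \<open>Two neighbourhoods of size \<open>2 ^ h - 2 * h\<close> have total size at least \<open>2 ^ h\<close>, because
  \<open>4 * h \<le> 2 ^ h\<close>, which is the bound that the counting argument for common neighbours needs.\<close>

lemma regular_diameter_two_complement_pow2:
  assumes h: "h \<ge> 4"
  shows "regular_diameter_two (complement_graph (pow2_circulant h)) (2 ^ h - 2 * h) (2 ^ h)"
proof -
  let ?G = "complement_graph (pow2_circulant h)"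
  have s0: "simple_graph (pow2_circulant h)"
    by (rule simple_graph_circulant) (rule pow2_connection_set)
  have V0: "verts (pow2_circulant h) = {0..<2 ^ h}" by (simp add: circulant_graph_def)
  have V: "verts ?G = {0..<2 ^ h}" by (simp add: complement_graph_def circulant_graph_def)
  have simple: "simple_graph ?G" by (rule simple_graph_complement) (rule s0)
  have deg: "degree ?G v = 2 ^ h - 2 * h" if "v \<in> verts ?G" for v
  proof -
    have v: "v < 2 ^ h" using that V by simp
    have "degree (pow2_circulant h) v = 2 * h - 1"
      using degree_circulant[OF pow2_connection_set v] card_pow2_and_negatives[of h] h by simp
    then show ?thesis using degree_complement[OF s0, of v] v V0 h by simp
  qed
  show ?thesis
  proof
    show "\<exists>w. {u, w} \<in> edges ?G \<and> {w, v} \<in> edges ?G"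
      if uv: "u \<in> verts ?G" "v \<in> verts ?G" "u \<noteq> v" "{u, v} \<notin> edges ?G" for u v
      using four_times_le_pow2[OF h] deg[OF uv(1)] deg[OF uv(2)]
      by (intro common_neighbour_if_large_degrees[OF simple uv]) (simp add: V)
  qed (use simple deg V in auto)
qed

theorem corollary5p6:
  fixes h n :: nat and \<Gamma> :: "nat ugraph"
  assumes "h \<ge> 4" and "n = 2 ^ h"
    and "\<Gamma> = complement_graph (circulant_graph n {2 ^ i | i. i < h})"
  shows
    "wiener_index \<Gamma> = real n * (real n + 2 * real h - 2) / 2 \<and>
     schultz_index \<Gamma> = real n * (real n - 2 * real h) * (real n + 2 * real h - 2) \<and>
     gutman_index \<Gamma> = real n * (real n + 2 * real h - 2) * (real n - 2 * real h)\<^sup>2 / 2 \<and>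
     hyper_wiener_index \<Gamma> = real n * (2 * real n + 8 * real h - 6) / 4 \<and>
     harary_index \<Gamma> = real n * (real n - real h - 1 / 2) / 2 \<and>
     additive_harary_index \<Gamma> = real n * (real n - 2 * real h) * (real n - real h - 1 / 2) \<and>
     multiplicative_harary_index \<Gamma> = real n * (real n - real h - 1 / 2) * (real n - 2 * real h)\<^sup>2 / 2 \<and>
     T_AG \<Gamma> = real n * (real n - 2 * real h) / 2 \<and>
     T_GA \<Gamma> = real n * (real n - 2 * real h) / 2 \<and>
     T_SC \<Gamma> = real n * (real n - 2 * real h) / (2 * sqrt 2 * sqrt (real n + 2 * real h - 2)) \<and>
     T_ABC \<Gamma> = real n * (real n - 2 * real h) * sqrt (real n + 2 * real h - 3) / (sqrt 2 * (real n + 2 * real h - 2)) \<and>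
     T_AZ \<Gamma> = real n * (real n - 2 * real h) * (real n + 2 * real h - 2) ^ 6 / (16 * (real n + 2 * real h - 3) ^ 3) \<and>
     RT_AG \<Gamma> = real n * (real n - 2 * real h) / 2 \<and>
     RT_GA \<Gamma> = real n * (real n - 2 * real h) / 2 \<and>
     RT_SC \<Gamma> = real n * (real n - 2 * real h) / (2 * sqrt (2 * real n - 2 * real h - 1)) \<and>
     RT_ABC \<Gamma> = real n * (real n - 2 * real h) * sqrt (2 * real n - 2 * real h - 3) / (2 * real n - 2 * real h - 1) \<and>
     RT_AZ \<Gamma> = real n * (2 * real h - real n) * (1 + 2 * real h - 2 * real n) ^ 6 / (128 * (3 + 2 * real h - 2 * real n) ^ 3)"
proof -
  interpret regular_diameter_two \<Gamma> "n - 2 * h" n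
    unfolding assms(2,3) by (rule regular_diameter_two_complement_pow2[OF assms(1)])
  have le: "4 * h \<le> n" using four_times_le_pow2[OF assms(1)] assms(2) by simp
  have d: "real (n - 2 * h) = real n - 2 * real h" using le by (simp add: of_nat_diff)
  have bound: "4 * real h \<le> real n" "4 \<le> real h"
    using le assms(1) by linarith+
  define s where "s = real n + 2 * real h - 2"
  \<comment> \<open>\<open>a\<close> is twice the reciprocal transmission, which keeps the closed forms free of fractions.\<close>
  define a where "a = 2 * real n - 2 * real h - 1"
  have s: "s > 1" and a: "a > 2" using bound by (simp_all add: s_def a_def)
  have trans: "\<forall>v \<in> verts \<Gamma>. transmission \<Gamma> v = s"
    by (simp add: transmission_eq d s_def)
  have recip: "\<forall>v \<in> verts \<Gamma>. reciprocal_transmission \<Gamma> v = a / 2"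
    by (simp add: reciprocal_transmission_eq d a_def)
  note T = edge_indices_constant_weight[OF trans s, unfolded d]
  have a2: "a / 2 > 1" using a by simp
  note R = edge_indices_constant_weight[OF recip a2, unfolded d]
  define m where "m = real n * (real n - 2 * real h)"
  have SC: "m / 2 * (1 / sqrt (2 * s)) = m / (2 * sqrt 2 * sqrt s)"
    by (simp add: real_sqrt_mult)
  have ABC: "m / 2 * (sqrt (2 * s - 2) / s) = m * sqrt (s - 1) / (sqrt 2 * s)"
  proof -
    have "sqrt (2 * s - 2) = sqrt 2 * sqrt (s - 1)" by (simp flip: real_sqrt_mult add: algebra_simps)
    moreover have "sqrt 2 * sqrt 2 = (2::real)" by simp
    ultimately show ?thesis using s by (simp add: field_simps)
  qed
  have AZ: "m / 2 * (s\<^sup>2 / (2 * s - 2)) ^ 3 = m * s ^ 6 / (16 * (s - 1) ^ 3)"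
  proof -
    have "2 * s - 2 = 2 * (s - 1)" by simp
    then show ?thesis by (simp only: power_divide power_mult_distrib flip: power_mult) simp
  qed
  have RAZ: "m / 2 * ((a / 2)\<^sup>2 / (2 * (a / 2) - 2)) ^ 3 = (- m) * (- a) ^ 6 / (128 * (2 - a) ^ 3)"
  proof -
    have dbl: "2 * (a / 2) - 2 = a - 2" by simp
    \<comment> \<open>the stated form negates both the numerator and the odd power in the denominator\<close>
    have neg: "(2 - a) ^ 3 = - ((a - 2) ^ 3)"
      using power_minus_odd[of 3 "a - 2"] by simp
    have "m / 2 * ((a / 2)\<^sup>2 / (2 * (a / 2) - 2)) ^ 3 = m / 2 * (a ^ 6 / 64 / (a - 2) ^ 3)"
      unfolding dbl by (simp only: power_divide flip: power_mult) simp
    also have "\<dots> = (- m) * (- a) ^ 6 / (128 * (2 - a) ^ 3)"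
      unfolding neg by simp
    finally show ?thesis .
  qed
  have in_terms_of_a_s_m: "1 + 2 * real h - 2 * real n = - a" "3 + 2 * real h - 2 * real n = 2 - a"
      "2 * real n - 2 * real h - 3 = a - 2" "2 * real n - 2 * real h - 1 = a"
      "real n + 2 * real h - 3 = s - 1" "real n * (2 * real h - real n) = - m"
    by (simp_all add: a_def s_def m_def algebra_simps)
  have "T_AG \<Gamma> = m / 2 \<and> T_GA \<Gamma> = m / 2 \<and> T_SC \<Gamma> = m / (2 * sqrt 2 * sqrt s) \<and>
      T_ABC \<Gamma> = m * sqrt (s - 1) / (sqrt 2 * s) \<and> T_AZ \<Gamma> = m * s ^ 6 / (16 * (s - 1) ^ 3)"
    unfolding T_AG_def T_GA_def T_SC_def T_ABC_def T_AZ_def T m_def[symmetric] SC ABC AZ by simp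
  moreover have "RT_AG \<Gamma> = m / 2 \<and> RT_GA \<Gamma> = m / 2 \<and> RT_SC \<Gamma> = m / (2 * sqrt a) \<and>
      RT_ABC \<Gamma> = m * sqrt (a - 2) / a \<and> RT_AZ \<Gamma> = (- m) * (- a) ^ 6 / (128 * (2 - a) ^ 3)"
    unfolding RT_AG_def RT_GA_def RT_SC_def RT_ABC_def RT_AZ_def R m_def[symmetric] RAZ by simp
  moreover have "2 * real n - 2 - (real n - 2 * real h) = s"
      "(real n - 1 + (real n - 2 * real h)) / 2 = real n - real h - 1 / 2"
      "6 * real n - 6 - 4 * (real n - 2 * real h) = 2 * real n + 8 * real h - 6"
    by (simp_all add: s_def field_simps)
  ultimately show ?thesis
    unfolding distance_indices d in_terms_of_a_s_m s_def[symmetric] m_def[symmetric] by simp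
qed

end
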